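(* Let $S$ be a poset. Then $\mathrm{Lex}(S)$ is a vector lattice if and only if $S$ is a forest.
   Context: All vector spaces are real. For a poset (partially ordered set) $S$, let $F_0(S)$ be the vector space of finitely supported functions $f\colon S \to \mathbb{R}$. $\mathrm{Lex}(S)$ denotes $F_0(S)$ equipped with the cone $$\mathrm{Lex}(S)_+ = \{f \in F_0(S) \colon \text{for every } s \in S,\ f(s) < 0 \text{ implies that there exists } t<s \text{ with } f(t) > 0\},$$ and ordered by $f \le g$ iff $g-f \in \mathrm{Lex}(S)_+$. A vector lattice is an ordered vector space in which every two elements have a supremum. A poset $S$ is called a forest if for each $s \in S$ the set $\{t \in S \colon t < s\}$ is totally ordered. The poset $S$ may be infinite. *)

theory Defs
  imports Complex_Main "HOL-Library.Poly_Mapping"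
begin

instantiation poly_mapping :: (type, real_vector) real_vector
begin

lift_definition scaleR_poly_mapping :: "real \<Rightarrow> ('a \<Rightarrow>\<^sub>0 'b) \<Rightarrow> ('a \<Rightarrow>\<^sub>0 'b)"
  is "\<lambda>c f x. c *\<^sub>R f x"
  by (erule finite_subset[rotated]) auto

instance
  by standard (transfer; simp add: fun_eq_iff scaleR_add_right scaleR_add_left)+

end

definition finsupp :: "'a set \<Rightarrow> ('a \<Rightarrow>\<^sub>0 real) set"
  where "finsupp S = {f. Poly_Mapping.keys f \<subseteq> S}"

definition lex_cone :: "'a set \<Rightarrow> 'a rel \<Rightarrow> ('a \<Rightarrow>\<^sub>0 real) set"
  where "lex_cone S r =
    {f \<in> finsupp S. \<forall>s\<in>S. Poly_Mapping.lookup f s < 0 \<longrightarrow> (\<exists>t\<in>underS r s. Poly_Mapping.lookup f t > 0)}"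

definition lex_order :: "'a set \<Rightarrow> 'a rel \<Rightarrow> ('a \<Rightarrow>\<^sub>0 real) rel"
  where "lex_order S r = {(f, g). f \<in> finsupp S \<and> g \<in> finsupp S \<and> g - f \<in> lex_cone S r}"

definition ordered_vector_space :: "'v::real_vector set \<Rightarrow> 'v rel \<Rightarrow> bool"
  where "ordered_vector_space V R \<longleftrightarrow>
    subspace V \<and> partial_order_on V R \<and>
    (\<forall>x\<in>V. \<forall>y\<in>V. \<forall>z\<in>V. (x, y) \<in> R \<longrightarrow> (x + z, y + z) \<in> R) \<and>
    (\<forall>x\<in>V. \<forall>y\<in>V. \<forall>c\<ge>0. (x, y) \<in> R \<longrightarrow> (c *\<^sub>R x, c *\<^sub>R y) \<in> R)"

definition is_supremum :: "'v set \<Rightarrow> 'v rel \<Rightarrow> 'v \<Rightarrow> 'v \<Rightarrow> 'v \<Rightarrow> bool"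
  where "is_supremum V R x y z \<longleftrightarrow>
    z \<in> V \<and> (x, z) \<in> R \<and> (y, z) \<in> R \<and>
    (\<forall>w\<in>V. (x, w) \<in> R \<and> (y, w) \<in> R \<longrightarrow> (z, w) \<in> R)"

definition vector_lattice :: "'v::real_vector set \<Rightarrow> 'v rel \<Rightarrow> bool"
  where "vector_lattice V R \<longleftrightarrow>
    ordered_vector_space V R \<and> (\<forall>x\<in>V. \<forall>y\<in>V. \<exists>z. is_supremum V R x y z)"

text \<open>\<^const>\<open>underS\<close> is the set of strict predecessors, and \<^const>\<open>total_on\<close> only compares
  distinct elements, which is total order because the ambient relation is a partial order.\<close>

definition forest :: "'a set \<Rightarrow> 'a rel \<Rightarrow> bool"
  where "forest S r \<longleftrightarrow> (\<forall>s\<in>S. total_on (underS r s) r)"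

end

theory Submission imports Defs begin

text \<open>An element of Lex(S) is positive iff it is positive at every minimal element of its finite
  support. In a forest, each point lies above at most one minimal element of the support of \<open>f\<close>,
  and restricting \<open>f\<close> to the points above a minimal element where \<open>f\<close> is positive gives the
  supremum of \<open>f\<close> and 0. Conversely, suppose \<open>s\<close> lies above the incomparable \<open>a\<close> and \<open>b\<close>, and \<open>z\<close>
  were a supremum of \<open>e\<^sub>a - e\<^sub>b\<close> and 0. Then all \<open>e\<^sub>a + c e\<^sub>s\<close> with \<open>c\<close> real are upper bounds, so
  \<open>e\<^sub>a - z\<close> must be positive somewhere below \<open>s\<close>; a minimal point of its support below \<open>s\<close>
  contradicts that \<open>z\<close> is an upper bound or, replacing \<open>s\<close>, that \<open>z\<close> is the least one.\<close>

section \<open>Minimal elements of finite sets\<close>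

definition min_elems :: "'a rel \<Rightarrow> 'a set \<Rightarrow> 'a set"
  where "min_elems r A = {m \<in> A. underS r m \<inter> A = {}}"

lemma underS_trans:
  assumes "partial_order_on S r" "x \<in> underS r y" "(y, z) \<in> r"
  shows "x \<in> underS r z"
  using assms(2,3) partial_order_onD(2,3)[OF assms(1)]
  by (auto simp: underS_def dest: transD antisymD)

text \<open>A minimal element of the part of \<open>A\<close> below \<open>s\<close> is minimal in
  all of \<open>A\<close>, since anything below it is again below \<open>s\<close>.\<close>

lemma ex_min_elem_below:
  assumes po: "partial_order_on S r" and fin: "finite A" and s: "s \<in> A" "s \<in> S"
  obtains m where "m \<in> min_elems r A" "(m, s) \<in> r"
proof -
  define B where "B = {x \<in> A. (x, s) \<in> r}"
  have refl: "(s, s) \<in> r"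
    using partial_order_onD(1)[OF po] s by (auto simp: refl_on_def)
  have "\<exists>m\<in>B. \<forall>x\<in>B. x \<noteq> m \<longrightarrow> \<not> x \<in> underS r m"
  proof (rule Finite_Set.bex_min_element)
    show "finite B" "B \<noteq> {}"
      using fin s refl by (auto simp: B_def)
    show "asymp_on B (\<lambda>x y. x \<in> underS r y)"
      using partial_order_onD(3)[OF po] by (auto simp: asymp_on_def underS_def dest: antisymD)
    show "transp_on B (\<lambda>x y. x \<in> underS r y)"
      using underS_trans[OF po] unfolding transp_on_def by (metis underS_E)
  qed
  then obtain m where m: "m \<in> B" "\<forall>x\<in>B. x \<notin> underS r m"
    by (auto simp: underS_def)
  have "x \<notin> underS r m" if "x \<in> A" for x
    using m that underS_trans[OF po, of x m s] by (auto simp: B_def underS_def)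
  with m show ?thesis
    by (intro that[of m]) (auto simp: B_def min_elems_def)
qed

section \<open>The lexicographic cone and its order\<close>

lemma finsupp_iff: "f \<in> finsupp S \<longleftrightarrow> (\<forall>x. x \<notin> S \<longrightarrow> Poly_Mapping.lookup f x = 0)"
  by (auto simp: finsupp_def in_keys_iff)

lemma lookup_scaleR [simp]:
  "Poly_Mapping.lookup (c *\<^sub>R f) x = c *\<^sub>R Poly_Mapping.lookup f x"
  by transfer simp

lemma subspace_finsupp: "subspace (finsupp S)"
  by (auto simp: subspace_def finsupp_iff lookup_add)

text \<open>Nothing below a minimal support point can compensate a negative value there. Conversely,
  every point with a negative value lies above a minimal support point, which does compensate
  it.\<close>

lemma mem_lex_cone_iff:
  assumes po: "partial_order_on S r"
  shows "f \<in> lex_cone S r \<longleftrightarrow>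
    f \<in> finsupp S \<and> (\<forall>m\<in>min_elems r (Poly_Mapping.keys f). Poly_Mapping.lookup f m > 0)"
proof (intro iffI conjI ballI; (elim conjE)?)
  assume f: "f \<in> lex_cone S r"
  then show "f \<in> finsupp S"
    by (simp add: lex_cone_def)
  fix m assume m: "m \<in> min_elems r (Poly_Mapping.keys f)"
  then have "m \<in> S" "Poly_Mapping.lookup f m \<noteq> 0"
    using f by (auto simp: lex_cone_def finsupp_def min_elems_def in_keys_iff)
  moreover have "\<not> Poly_Mapping.lookup f m < 0"
  proof
    assume "Poly_Mapping.lookup f m < 0"
    then obtain t where "t \<in> underS r m" "Poly_Mapping.lookup f t > 0"
      using f \<open>m \<in> S\<close> by (auto simp: lex_cone_def)
    then show False
      using m by (auto simp: min_elems_def in_keys_iff)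
  qed
  ultimately show "Poly_Mapping.lookup f m > 0"
    by simp
next
  assume f: "f \<in> finsupp S"
    and pos: "\<forall>m\<in>min_elems r (Poly_Mapping.keys f). Poly_Mapping.lookup f m > 0"
  have "\<exists>t\<in>underS r s. Poly_Mapping.lookup f t > 0"
    if s: "s \<in> S" "Poly_Mapping.lookup f s < 0" for s
  proof -
    obtain m where m: "m \<in> min_elems r (Poly_Mapping.keys f)" "(m, s) \<in> r"
      by (rule ex_min_elem_below[OF po finite_keys, of s f]) (use s in \<open>auto simp: in_keys_iff\<close>)
    then show ?thesis
      using pos s by (intro bexI[of _ m]) (auto simp: underS_def)
  qed
  with f show "f \<in> lex_cone S r"
    by (simp add: lex_cone_def)
qed

text \<open>A minimal point of the union of both supports is minimal in each support containing it,
  so no positive value there is cancelled.\<close>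

lemma lex_cone_add:
  assumes po: "partial_order_on S r" and f: "f \<in> lex_cone S r" and g: "g \<in> lex_cone S r"
  shows "f + g \<in> lex_cone S r"
proof -
  have S: "f \<in> finsupp S" "g \<in> finsupp S"
    using f g by (auto simp: lex_cone_def)
  have "\<exists>t\<in>underS r s. Poly_Mapping.lookup (f + g) t > 0"
    if s: "s \<in> S" "Poly_Mapping.lookup (f + g) s < 0" for s
  proof -
    let ?A = "Poly_Mapping.keys f \<union> Poly_Mapping.keys g"
    have "s \<in> ?A"
      using s by (auto simp: in_keys_iff lookup_add)
    then obtain m where m: "m \<in> min_elems r ?A" "(m, s) \<in> r"
      using ex_min_elem_below[OF po, of ?A s] s by (metis finite_Un finite_keys)
    have "m \<in> min_elems r (Poly_Mapping.keys h)"
      if "h \<in> {f, g}" "m \<in> Poly_Mapping.keys h" for h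
      using m that by (auto simp: min_elems_def)
    then have "Poly_Mapping.lookup h m > 0" if "h \<in> {f, g}" "Poly_Mapping.lookup h m \<noteq> 0" for h
      using f g that by (auto simp: mem_lex_cone_iff[OF po] in_keys_iff)
    then have "Poly_Mapping.lookup f m \<ge> 0" "Poly_Mapping.lookup g m \<ge> 0"
      "Poly_Mapping.lookup f m \<noteq> 0 \<or> Poly_Mapping.lookup g m \<noteq> 0"
      using m by (force simp: less_le, force simp: less_le, auto simp: min_elems_def in_keys_iff)
    then have "Poly_Mapping.lookup (f + g) m > 0"
      by (auto simp: lookup_add)
    with m s show ?thesis
      by (intro bexI[of _ m]) (auto simp: underS_def)
  qed
  then show ?thesis
    using subspace_add[OF subspace_finsupp S] by (simp add: lex_cone_def)
qed

text \<open>\<open>f\<close> and \<open>- f\<close> have the same support; at a minimal point of it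
  both would have to be positive.\<close>

lemma lex_cone_pointed:
  assumes po: "partial_order_on S r" and f: "f \<in> lex_cone S r" "- f \<in> lex_cone S r"
  shows "f = 0"
proof (rule ccontr)
  assume "f \<noteq> 0"
  then obtain s where s: "s \<in> Poly_Mapping.keys f"
    by fastforce
  moreover have "s \<in> S"
    using s f by (auto simp: lex_cone_def finsupp_def)
  ultimately obtain m where "m \<in> min_elems r (Poly_Mapping.keys f)"
    using ex_min_elem_below[OF po finite_keys] by metis
  then show False
    using f by (fastforce simp: mem_lex_cone_iff[OF po])
qed

lemma lex_cone_scaleR:
  assumes "f \<in> lex_cone S r" "c \<ge> 0"
  shows "c *\<^sub>R f \<in> lex_cone S r"
proof (cases "c = 0")
  case False
  then show ?thesis
    using assms subspace_scale[OF subspace_finsupp]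
    by (auto simp: lex_cone_def mult_less_0_iff zero_less_mult_iff)
qed (simp add: lex_cone_def finsupp_def)

lemma ordered_vector_space_lex:
  assumes po: "partial_order_on S r"
  shows "ordered_vector_space (finsupp S) (lex_order S r)"
  unfolding ordered_vector_space_def
proof (intro conjI ballI allI impI)
  show "subspace (finsupp S)"
    by (rule subspace_finsupp)
  have "0 \<in> lex_cone S r"
    by (simp add: lex_cone_def finsupp_def)
  moreover have "f = g" if "f - g \<in> lex_cone S r" "g - f \<in> lex_cone S r" for f g
    using lex_cone_pointed[OF po, of "f - g"] that by simp
  moreover have "h - f \<in> lex_cone S r" if "g - f \<in> lex_cone S r" "h - g \<in> lex_cone S r" for f g h
    using lex_cone_add[OF po that] by simp
  ultimately show "partial_order_on (finsupp S) (lex_order S r)"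
    by (auto simp: partial_order_on_def preorder_on_def refl_on_def lex_order_def
        intro!: transI antisymI)
next
  fix x y z :: "'a \<Rightarrow>\<^sub>0 real"
  assume "x \<in> finsupp S" "y \<in> finsupp S" "z \<in> finsupp S" "(x, y) \<in> lex_order S r"
  then show "(x + z, y + z) \<in> lex_order S r"
    by (auto simp: lex_order_def intro: subspace_add[OF subspace_finsupp])
next
  fix x y :: "'a \<Rightarrow>\<^sub>0 real" and c :: real
  assume "x \<in> finsupp S" "y \<in> finsupp S" "0 \<le> c" "(x, y) \<in> lex_order S r"
  then show "(c *\<^sub>R x, c *\<^sub>R y) \<in> lex_order S r"
    using lex_cone_scaleR[of "y - x" S r c]
    by (auto simp: lex_order_def scaleR_diff_right intro: subspace_scale[OF subspace_finsupp])
qed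

section \<open>Suprema over a forest\<close>

lemma ex_supremum_if_forest:
  assumes po: "partial_order_on S r" and forest: "forest S r" and f: "f \<in> finsupp S"
  shows "\<exists>p. is_supremum (finsupp S) (lex_order S r) f 0 p"
proof -
  let ?l = Poly_Mapping.lookup
  note trans = transD[OF partial_order_onD(2)[OF po]]
  define M where "M = min_elems r (Poly_Mapping.keys f)"
  \<comment> \<open>\<open>P\<close> is the up-set generated by the minimal support points where
    \<open>f\<close> is positive; the supremum will be \<open>f\<close> cut down to
    \<open>P\<close>.\<close>
  define P where "P = {s. \<exists>m\<in>M. (m, s) \<in> r \<and> ?l f m > 0}"
  define p where "p = Poly_Mapping.mapp (\<lambda>s x. if s \<in> P then x else 0) f"
  have lp: "?l p s = (if s \<in> P then ?l f s else 0)" for s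
    by (simp add: p_def lookup_mapp when_def in_keys_iff)
  have P_up: "t \<in> P" if "s \<in> P" "(s, t) \<in> r" for s t
    using that trans by (auto simp: P_def)
  have pS: "p \<in> finsupp S"
    using f by (auto simp: finsupp_iff lp)
  have "p \<in> lex_cone S r"
    unfolding mem_lex_cone_iff[OF po]
  proof (intro conjI pS ballI)
    fix s assume s: "s \<in> min_elems r (Poly_Mapping.keys p)"
    then have "s \<in> P"
      by (auto simp: min_elems_def in_keys_iff lp split: if_splits)
    then obtain m where m: "m \<in> M" "(m, s) \<in> r" "?l f m > 0"
      by (auto simp: P_def)
    have "m \<in> P"
      using m partial_order_onD(1,4)[OF po] by (auto simp: P_def refl_on_def)
    moreover have "m = s"
      using s m \<open>m \<in> P\<close> by (auto simp: min_elems_def in_keys_iff lp underS_def)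
    ultimately show "?l p s > 0"
      using m by (simp add: lp)
  qed
  moreover have "p - f \<in> lex_cone S r"
    unfolding mem_lex_cone_iff[OF po]
  proof (intro conjI ballI)
    show "p - f \<in> finsupp S"
      using subspace_diff[OF subspace_finsupp pS f] .
    fix s assume s: "s \<in> min_elems r (Poly_Mapping.keys (p - f))"
    then have sP: "s \<notin> P" and fs: "?l f s \<noteq> 0"
      by (auto simp: min_elems_def in_keys_iff lp lookup_minus split: if_splits)
    \<comment> \<open>As \<open>P\<close> is an up-set, \<open>p\<close> vanishes at and below
      \<open>s\<close>. Hence \<open>s\<close> is minimal in the support of \<open>f\<close>, and
      \<open>s \<notin> P\<close> forces \<open>f\<close> to be negative there.\<close>
    have "t \<notin> Poly_Mapping.keys f" if "t \<in> underS r s" for t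
    proof -
      have "t \<notin> P"
        using P_up sP that by (auto simp: underS_def)
      then show ?thesis
        using s that by (auto simp: min_elems_def in_keys_iff lp lookup_minus)
    qed
    then have "s \<in> M"
      using fs by (auto simp: M_def min_elems_def in_keys_iff)
    moreover have "(s, s) \<in> r"
      using fs f partial_order_onD(1)[OF po] by (auto simp: finsupp_iff refl_on_def)
    ultimately show "?l (p - f) s > 0"
      using sP fs by (force simp: lookup_minus lp P_def)
  qed
  moreover have "g - p \<in> lex_cone S r"
    if g: "g \<in> lex_cone S r" and gf: "g - f \<in> lex_cone S r" for g
  proof -
    have "\<exists>t\<in>underS r s. ?l (g - p) t > 0" if s: "s \<in> S" "?l (g - p) s < 0" for s
    \<comment> \<open>On \<open>P\<close> the function \<open>p\<close> agrees with
      \<open>f\<close>, so \<open>g - f\<close> supplies the positive value; off \<open>P\<close> it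
      is zero, so \<open>g\<close> does.\<close>
    proof (cases "s \<in> P")
      case True
      then have "?l (g - f) s < 0"
        using s by (simp add: lookup_minus lp)
      then obtain t where t: "t \<in> underS r s" "?l (g - f) t > 0"
        using gf s by (auto simp: lex_cone_def)
      obtain m where m: "m \<in> M" "(m, s) \<in> r" "?l f m > 0"
        using True by (auto simp: P_def)
      have "?l (g - p) t > 0"
      proof (cases "t \<in> P")
        case True
        with t show ?thesis
          by (simp add: lookup_minus lp)
      next
        case False
        have "(m, m) \<in> r"
          using m partial_order_onD(1,4)[OF po] by (auto simp: refl_on_def)
        then have "t \<noteq> m" "(m, t) \<notin> r"
          using False m by (auto simp: P_def)
        \<comment> \<open>The forest property enters here: \<open>t\<close> and \<open>m\<close> are
          comparable below \<open>s\<close>, and \<open>t\<close> above \<open>m\<close> would lie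
          in \<open>P\<close>.\<close>
        then have "t \<in> underS r m"
          using forest s t m by (cases "m = s") (auto simp: forest_def total_on_def underS_def)
        then have "?l f t = 0"
          using m by (auto simp: M_def min_elems_def in_keys_iff)
        with t show ?thesis
          by (simp add: lookup_minus lp)
      qed
      with t show ?thesis
        by blast
    next
      case False
      then obtain t where t: "t \<in> underS r s" "?l g t > 0"
        using g s by (auto simp: lex_cone_def lookup_minus lp)
      then have "t \<notin> P"
        using False P_up by (auto simp: underS_def)
      with t show ?thesis
        by (auto simp: lookup_minus lp)
    qed
    moreover have "g \<in> finsupp S"
      using g by (simp add: lex_cone_def)
    ultimately show ?thesis
      using subspace_diff[OF subspace_finsupp _ pS] by (simp add: lex_cone_def)
  qed
  moreover have "0 \<in> finsupp S"
    by (simp add: finsupp_def)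
  ultimately show ?thesis
    using f pS by (auto simp: is_supremum_def lex_order_def)
qed

text \<open>With \<open>f = x - y\<close> this reduces suprema of arbitrary pairs to suprema with
  0.\<close>

lemma is_supremum_lex_translate:
  assumes "is_supremum (finsupp S) (lex_order S r) f 0 p" and y: "y \<in> finsupp S"
  shows "is_supremum (finsupp S) (lex_order S r) (f + y) y (p + y)"
  unfolding is_supremum_def
proof (intro conjI ballI impI)
  note S = subspace_add[OF subspace_finsupp _ y] subspace_diff[OF subspace_finsupp _ y]
  note sup = assms(1)[unfolded is_supremum_def lex_order_def]
  show "p + y \<in> finsupp S" "(f + y, p + y) \<in> lex_order S r" "(y, p + y) \<in> lex_order S r"
    using sup y S by (auto simp: lex_order_def)
  fix w assume w: "w \<in> finsupp S" "(f + y, w) \<in> lex_order S r \<and> (y, w) \<in> lex_order S r"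
  have "w - y - f = w - (f + y)" "w - y - p = w - (p + y)"
    by simp_all
  moreover have "w - y \<in> finsupp S"
    using w S by simp
  ultimately have "w - (p + y) \<in> lex_cone S r"
    using w sup unfolding lex_order_def by (metis (no_types, lifting) case_prodD case_prodI diff_zero mem_Collect_eq)
  then show "(p + y, w) \<in> lex_order S r"
    using w sup S by (simp add: lex_order_def)
qed

section \<open>Missing suprema below a point with incomparable predecessors\<close>

lemma not_is_supremum_if_incomparable:
  assumes po: "partial_order_on S r" and s: "s \<in> S" and ab: "a \<in> underS r s" "b \<in> underS r s"
    and inc: "(a, b) \<notin> r" "(b, a) \<notin> r"
  shows "\<not> is_supremum (finsupp S) (lex_order S r)
    (Poly_Mapping.single a 1 - Poly_Mapping.single b 1) 0 z"
proof
  let ?l = Poly_Mapping.lookup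
  let ?e = "\<lambda>x. Poly_Mapping.single x (1::real)"
  assume sup: "is_supremum (finsupp S) (lex_order S r) (?e a - ?e b) 0 z"
  have S: "a \<in> S" "b \<in> S"
    using ab partial_order_onD(4)[OF po] by (auto simp: underS_def)
  have "a \<noteq> b"
    using inc S partial_order_onD(1)[OF po] by (auto simp: refl_on_def)
  have eS: "?e x \<in> finsupp S" if "x \<in> S" for x
    using that by (simp add: finsupp_def)
  have z: "z \<in> lex_cone S r" "z - (?e a - ?e b) \<in> lex_cone S r" "z \<in> finsupp S"
    using sup by (auto simp: is_supremum_def lex_order_def)
  \<comment> \<open>\<open>z\<close> lies below \<open>e\<^sub>a + c e\<^sub>s\<close> for every real \<open>c\<close>; take \<open>c\<close> very negative.\<close>
  have below: "\<exists>t\<in>underS r u. t \<in> min_elems r (Poly_Mapping.keys (?e a - z)) \<and> ?l z t < ?l (?e a) t"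
    if u: "u \<in> S" "a \<in> underS r u" "b \<in> underS r u" for u
  proof -
    \<comment> \<open>This choice gives \<open>w - z\<close> the value -1 at \<open>u\<close>. In
      \<open>w\<close> and in \<open>w - (?e a - ?e b)\<close> only the value at \<open>u\<close>
      can be negative, and it is compensated at \<open>a\<close> and \<open>b\<close>
      respectively.\<close>
    define c where "c = ?l z u - 1"
    define w where "w = ?e a + c *\<^sub>R ?e u"
    have wS: "w \<in> finsupp S" "w - (?e a - ?e b) \<in> finsupp S"
      using S u eS unfolding w_def
      by (auto intro!: subspace_add[OF subspace_finsupp] subspace_scale[OF subspace_finsupp]
          subspace_diff[OF subspace_finsupp])
    have ne: "a \<noteq> u" "b \<noteq> u"
      using u by (auto simp: underS_def)
    have "w \<in> lex_cone S r"
      using u ne wS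
      by (auto simp: lex_cone_def w_def lookup_add lookup_single when_def split: if_splits
          intro!: bexI[of _ a])
    moreover have "w - (?e a - ?e b) \<in> lex_cone S r"
      using u ne wS
      by (auto simp: lex_cone_def w_def lookup_add lookup_minus lookup_single when_def
          split: if_splits intro!: bexI[of _ b])
    ultimately have "w - z \<in> lex_cone S r"
      using sup wS by (auto simp: is_supremum_def lex_order_def)
    moreover have wu: "?l (w - z) u < 0"
      using ne by (simp add: w_def c_def lookup_add lookup_minus lookup_single)
    moreover obtain t where t: "t \<in> min_elems r (Poly_Mapping.keys (w - z))" "(t, u) \<in> r"
      by (rule ex_min_elem_below[OF po finite_keys, of u "w - z"]) (use u wu in \<open>auto simp: in_keys_iff\<close>)
    ultimately have pos: "?l (w - z) t > 0"
      by (auto simp: mem_lex_cone_iff[OF po])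
    with t wu have tu: "t \<in> underS r u"
      by (auto simp: underS_def)
    \<comment> \<open>\<open>w\<close> and \<open>?e a\<close> differ only at \<open>u\<close>, so
      minimality of \<open>t\<close> carries over to the support of \<open>?e a - z\<close>.\<close>
    have eq: "?l (w - z) x = ?l (?e a - z) x" if "x \<in> underS r u" for x
      using that by (auto simp: w_def underS_def lookup_add lookup_minus lookup_single when_def)
    have "x \<notin> Poly_Mapping.keys (?e a - z)" if "x \<in> underS r t" for x
      using t(1) that eq[OF underS_trans[OF po that t(2)]] by (auto simp: min_elems_def in_keys_iff)
    then have "t \<in> min_elems r (Poly_Mapping.keys (?e a - z))"
      using pos eq[OF tu] by (auto simp: min_elems_def in_keys_iff)
    with pos tu eq[OF tu] show ?thesis
      by (auto simp: lookup_minus)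
  qed
  obtain t where t: "t \<in> underS r s" "t \<in> min_elems r (Poly_Mapping.keys (?e a - z))"
      "?l z t < ?l (?e a) t"
    using below[OF s ab] by blast
  have tS: "t \<in> S"
    using t partial_order_onD(4)[OF po] by (auto simp: underS_def)
  have eq: "?l z x = ?l (?e a) x" if "x \<in> underS r t" for x
    using that t by (auto simp: min_elems_def in_keys_iff lookup_minus)
  \<comment> \<open>If \<open>t \<noteq> a\<close>, then \<open>z\<close> is negative at
    \<open>t\<close> and needs a positive value below; there \<open>z\<close> agrees with
    \<open>?e a\<close>, so that point is \<open>a\<close>.\<close>
  have at: "a \<in> underS r t" if "t \<noteq> a"
  proof -
    have "?l z t < 0"
      using t that by (simp add: lookup_single)
    then obtain u where "u \<in> underS r t" "?l z u > 0"
      using z tS by (auto simp: lex_cone_def)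
    then show ?thesis
      using eq by (auto simp: lookup_single when_def split: if_splits)
  qed
  have "t \<noteq> b"
    using at inc \<open>a \<noteq> b\<close> by (auto simp: underS_def)
  then have "?l (z - (?e a - ?e b)) t < 0"
    using t by (simp add: lookup_minus lookup_single)
  \<comment> \<open>Below \<open>t\<close> this difference agrees with \<open>?e b\<close>, so
    \<open>u\<close> must be \<open>b\<close>.\<close>
  then obtain u where "u \<in> underS r t" "?l (z - (?e a - ?e b)) u > 0"
    using z tS by (auto simp: lex_cone_def)
  then have bt: "b \<in> underS r t"
    using eq by (auto simp: lookup_minus lookup_single when_def split: if_splits)
  then have "t \<noteq> a"
    using inc by (auto simp: underS_def)
  \<comment> \<open>Now \<open>t\<close> lies above both \<open>a\<close> and \<open>b\<close>, so
    it can replace \<open>s\<close>; this yields a support point strictly below the minimal point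
    \<open>t\<close>.\<close>
  from below[OF tS at[OF this] bt] show False
    using t by (auto simp: min_elems_def)
qed

theorem theorem3p4:
  fixes S :: "'a set" and r :: "'a rel"
  assumes "partial_order_on S r"
  shows "vector_lattice (finsupp S) (lex_order S r) \<longleftrightarrow> forest S r"
proof
  assume L: "vector_lattice (finsupp S) (lex_order S r)"
  show "forest S r"
    unfolding forest_def total_on_def
  proof (intro ballI impI)
    fix s a b assume "s \<in> S" "a \<in> underS r s" "b \<in> underS r s"
    moreover from this have "a \<in> S" "b \<in> S"
      using partial_order_onD(4)[OF assms] by (auto simp: underS_def)
    then have "Poly_Mapping.single a 1 - Poly_Mapping.single b 1 \<in> finsupp S" "0 \<in> finsupp S"
      by (auto simp: finsupp_iff lookup_minus lookup_single when_def)
    ultimately show "(a, b) \<in> r \<or> (b, a) \<in> r"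
      using L not_is_supremum_if_incomparable[OF assms] unfolding vector_lattice_def by blast
  qed
next
  assume F: "forest S r"
  show "vector_lattice (finsupp S) (lex_order S r)"
    unfolding vector_lattice_def
  proof (intro conjI ballI ordered_vector_space_lex[OF assms])
    fix x y :: "'a \<Rightarrow>\<^sub>0 real" assume xy: "x \<in> finsupp S" "y \<in> finsupp S"
    obtain p where "is_supremum (finsupp S) (lex_order S r) (x - y) 0 p"
      using ex_supremum_if_forest[OF assms F subspace_diff[OF subspace_finsupp xy]] by blast
    from is_supremum_lex_translate[OF this xy(2)]
    show "\<exists>z. is_supremum (finsupp S) (lex_order S r) x y z"
      by auto
  qed
qed

end
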